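(* Let $n\in\mathbb N$, let $Y_1,\dots,Y_n$ be linearly ordered spaces, and let $Y\subseteq Y_1\times\cdots\times Y_n$ be a compact subspace such that for every (possibly empty) parallelepiped $$W=[a_1,b_1]\times\dots\times[a_n,b_n]\subseteq Y_1\times\cdots\times Y_n$$ the set $Y\cap W$ is connected. Then $Y$ is a co-Namioka space.
   Context: A linearly ordered space is a linearly ordered set endowed with its order topology; products carry the product topology. For points $a\le b$ of a linearly ordered space, $[a,b]$ denotes the closed interval $\{t: a\le t\le b\}$. The empty set is regarded as connected. Let $X$, $Y$ be topological spaces. A function $f:X\times Y\to\mathbb R$ is separately continuous if for every $x\in X$ the function $y\mapsto f(x,y)$ is continuous on $Y$ and for every $y\in Y$ the function $x\mapsto f(x,y)$ is continuous on $X$. A separately continuous function $f:X\times Y\to\mathbb R$ has the Namioka property if there exists a dense in $X$ $G_\delta$-set $A\subseteq X$ such that $f$ is jointly continuous at every point of $A\times Y$ (that is, continuous with respect to the product topology on $X\times Y$ at each such point). A compact space $Y$ is called a co-Namioka space if for every Baire space $X$ each separately continuous function $f:X\times Y\to\mathbb R$ has the Namioka property. *)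

theory Defs
  imports "HOL-Analysis.Analysis"
begin

text \<open>
  A linearly ordered set is a carrier \<open>L\<close> with a reflexive order relation \<open>r\<close> such that
  \<open>linear_order_on L r\<close>. The carrier belongs to the subbase of the order topology so that
  a one-point set gets its (only) topology.
\<close>

definition order_topology_on :: "'a set \<Rightarrow> 'a rel \<Rightarrow> 'a topology" where
  "order_topology_on L r =
     topology_generated_by
       (insert L ({{x \<in> L. (x, a) \<in> r \<and> x \<noteq> a} |a. a \<in> L} \<union>
                  {{x \<in> L. (a, x) \<in> r \<and> a \<noteq> x} |a. a \<in> L}))"

lemma topspace_order_topology_on [simp]: "topspace (order_topology_on L r) = L"
  unfolding order_topology_on_def by (auto simp del: insert_iff)

text \<open>On a type of class \<^class>\<open>linorder_topology\<close> this is the topology of the type.\<close>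

lemma order_topology_on_UNIV:
  "order_topology_on UNIV {(x, y). x \<le> y} = (euclidean :: 'a::linorder_topology topology)"
proof (rule topology_eq[THEN iffD2], intro allI)
  fix S :: "'a set"
  let ?B = "range (\<lambda>a::'a. {..<a}) \<union> range (\<lambda>a. {a<..})"
  have B: "insert UNIV ({{x \<in> UNIV. (x, a) \<in> {(x, y). x \<le> y} \<and> x \<noteq> a} |a. a \<in> (UNIV::'a set)} \<union>
                  {{x \<in> UNIV. (a, x) \<in> {(x, y). x \<le> y} \<and> a \<noteq> x} |a. a \<in> UNIV}) = insert UNIV ?B"
    by (auto simp: less_le)
  have 1: "generate_topology ?B S" if "generate_topology_on (insert UNIV ?B) S"
    using that
  proof induction
    case Empty
    show ?case using generate_topology.UN[of "{}" ?B] by simp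
  qed (auto intro: generate_topology.intros)
  have 2: "generate_topology_on (insert UNIV ?B) S" if "generate_topology ?B S"
    using that by induction (auto intro: generate_topology_on.intros)
  show "openin (order_topology_on UNIV {(x, y). x \<le> y}) S = openin euclidean S"
    unfolding order_topology_on_def B openin_topology_generated_by_iff
    unfolding open_openin[symmetric]
    unfolding open_generated_order using 1 2 by blast
qed

text \<open>Empty unless \<open>(a, b) \<in> r\<close>, if \<open>r\<close> is transitive.\<close>

definition order_interval :: "'a rel \<Rightarrow> 'a \<Rightarrow> 'a \<Rightarrow> 'a set" where
  "order_interval r a b = {t. (a, t) \<in> r \<and> (t, b) \<in> r}"

definition Baire_space :: "'a topology \<Rightarrow> bool" where
  "Baire_space X \<longleftrightarrow>
     (\<forall>U :: nat \<Rightarrow> 'a set.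
        (\<forall>k. openin X (U k) \<and> X closure_of (U k) = topspace X)
        \<longrightarrow> X closure_of (\<Inter>k. U k) = topspace X)"

definition separately_continuous ::
  "'x topology \<Rightarrow> 'y topology \<Rightarrow> ('x \<times> 'y \<Rightarrow> real) \<Rightarrow> bool" where
  "separately_continuous X Y f \<longleftrightarrow>
     (\<forall>x \<in> topspace X. continuous_map Y euclideanreal (\<lambda>y. f (x, y))) \<and>
     (\<forall>y \<in> topspace Y. continuous_map X euclideanreal (\<lambda>x. f (x, y)))"

definition Namioka_property ::
  "'x topology \<Rightarrow> 'y topology \<Rightarrow> ('x \<times> 'y \<Rightarrow> real) \<Rightarrow> bool" where
  "Namioka_property X Y f \<longleftrightarrow>
     (\<exists>A. gdelta_in X A \<and> X closure_of A = topspace X \<and>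
          (\<forall>p \<in> A \<times> topspace Y. topcontinuous_at (prod_topology X Y) euclideanreal f p))"

text \<open>
  HOL cannot quantify over types inside a formula, so the type of the points of \<open>X\<close> is a
  parameter. A theorem with conclusion \<open>co_Namioka_space TYPE('x) Y\<close> for a type
  variable \<open>'x\<close> not occurring in \<open>Y\<close> covers all Baire spaces \<open>X\<close>.
\<close>

definition co_Namioka_space :: "'x itself \<Rightarrow> 'y topology \<Rightarrow> bool" where
  "co_Namioka_space _ Y \<longleftrightarrow>
     compact_space Y \<and>
     (\<forall>(X :: 'x topology) f.
        Baire_space X \<longrightarrow> separately_continuous X Y f \<longrightarrow> Namioka_property X Y f)"

end

theory Submission
  imports Defs
begin

text \<open>
  Fix \<open>\<delta> > 0\<close>. By compactness of \<open>Y\<close>, every section \<open>f (x, \<cdot>)\<close> has a finite grid: finitely many cuts on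
  the axes such that the section varies by at most \<open>\<delta>\<close> on each cell of \<open>Y\<close> determined by the
  trichotomy \<open><\<close>, \<open>=\<close>, \<open>>\<close> relative to the cuts. The cuts of a given shape form a compact space, so the
  set of \<open>x\<close> with a grid of that shape is a closed projection, and the Baire property yields an open
  set of \<open>x\<close> sharing one shape. Choose the shape with the fewest cuts. Near a point at which no cut
  can be dropped, compactness again gives a finite set \<open>H\<close>, independent of \<open>x\<close>, that separates any
  two cuts of a grid on the same axis. Two points \<open>u\<close>, \<open>v\<close> of \<open>Y\<close> in the same cell of \<open>H\<close> then span a
  parallelepiped that meets at most one cut per axis, hence at most \<open>3 ^ n\<close> cells of the grid; as its
  intersection with \<open>Y\<close> is connected, \<open>f (x, u)\<close> and \<open>f (x, v)\<close> differ by at most \<open>3 ^ n * \<delta>\<close>. So on a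
  nonempty open set of \<open>x\<close> the sections are uniformly controlled by their values at one point in each
  cell of \<open>H\<close>.
\<close>

subsection \<open>Baire spaces and the Namioka property\<close>

text \<open>This is the category argument inside an open set: if no member of \<open>\<C>\<close>
  contained a nonempty open part of \<open>U\<close>, the complements of the members would give
  dense open sets whose intersection meets \<open>U\<close> outside
  \<open>\<Union>\<C>\<close>.\<close>

lemma Baire_space_open_subset_closed:
  assumes X: "Baire_space X" and U: "openin X U" "U \<noteq> {}"
    and \<C>: "countable \<C>" "\<And>C. C \<in> \<C> \<Longrightarrow> closedin X C" "U \<subseteq> \<Union>\<C>"
  shows "\<exists>C\<in>\<C>. \<exists>V. openin X V \<and> V \<noteq> {} \<and> V \<subseteq> U \<inter> C"
proof (rule ccontr)
  assume "\<not> ?thesis"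
  then have *: "\<And>C V. C \<in> \<C> \<Longrightarrow> openin X V \<Longrightarrow> V \<noteq> {} \<Longrightarrow> \<not> V \<subseteq> U \<inter> C"
    by blast
  have "\<C> \<noteq> {}" using U \<C>(3) by auto
  define S where "S = from_nat_into \<C>"
  have S: "range S = \<C>" unfolding S_def by (rule range_from_nat_into[OF \<open>\<C> \<noteq> {}\<close> \<C>(1)])
  \<comment> \<open>The exterior of \<open>U\<close> is added so that \<open>W k\<close> is dense in
    the whole space and not merely near \<open>U\<close>.\<close>
  define W where "W k = (topspace X - S k) \<union> (topspace X - X closure_of U)" for k
  have cl: "closedin X (S k)" for k using \<C>(2) S by blast
  have op: "openin X (W k)" for k
    unfolding W_def by (intro openin_Un openin_diff openin_topspace cl closedin_closure_of)
  have "X closure_of (W k) = topspace X" for k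
    unfolding dense_intersects_open
  proof (intro allI impI notI)
    fix T assume T: "openin X T \<and> T \<noteq> {}" and e: "W k \<inter> T = {}"
    then have "T \<subseteq> S k" "T \<subseteq> X closure_of U"
      using openin_subset[of X T] unfolding W_def by fast+
    then have "T \<inter> U \<noteq> {}"
      using T openin_Int_closure_of_eq_empty[of X T U] by auto
    moreover have "openin X (T \<inter> U)" using T U by (simp add: openin_Int)
    moreover have "S k \<in> \<C>" "T \<inter> U \<subseteq> U \<inter> S k" using S \<open>T \<subseteq> S k\<close> by auto
    ultimately show False using * by metis
  qed
  with op X have "X closure_of (\<Inter>k. W k) = topspace X"
    unfolding Baire_space_def by blast
  then have "(\<Inter>k. W k) \<inter> U \<noteq> {}"
    using U unfolding dense_intersects_open by simp
  then obtain x where x: "x \<in> U" "\<And>k. x \<in> W k" by auto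
  then have "x \<in> X closure_of U"
    using closure_of_subset[of U X] openin_subset[OF U(1)] by auto
  with x(2) have "x \<notin> S k" for k unfolding W_def by auto
  with x(1) \<C>(3) S show False by blast
qed

lemma open_minus_finite_closed_nonempty:
  assumes "finite \<C>" "openin X V" "V \<noteq> {}" "\<And>C. C \<in> \<C> \<Longrightarrow> closedin X C"
    "\<And>C W. C \<in> \<C> \<Longrightarrow> openin X W \<Longrightarrow> W \<noteq> {} \<Longrightarrow> W \<subseteq> V \<Longrightarrow> \<not> W \<subseteq> C"
  shows "openin X (V - \<Union>\<C>) \<and> V - \<Union>\<C> \<noteq> {}"
  using assms(1,4,5)
proof (induction \<C>)
  case empty
  then show ?case using assms by simp
next
  case (insert C \<C>)
  then have IH: "openin X (V - \<Union>\<C>)" "V - \<Union>\<C> \<noteq> {}" by auto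
  have "V - \<Union>(insert C \<C>) = (V - \<Union>\<C>) - C" by auto
  moreover have "\<not> V - \<Union>\<C> \<subseteq> C"
    using insert.prems(2)[of C "V - \<Union>\<C>"] IH by auto
  ultimately show ?case
    using IH insert.prems(1)[of C] by (auto intro: openin_diff)
qed

text \<open>For each k, the open sets on which f varies in x by at most 1/(k+1), uniformly in y,
  have a dense open union. The intersection of these unions is the required dense G-delta set. Joint
  continuity there combines the uniform control in x with continuity of a single section in
  y.\<close>

lemma Namioka_propertyI:
  assumes X: "Baire_space X" and f: "separately_continuous X Y f"
    and small: "\<And>U \<epsilon>. openin X U \<Longrightarrow> U \<noteq> {} \<Longrightarrow> \<epsilon> > 0 \<Longrightarrow>
      \<exists>V. openin X V \<and> V \<noteq> {} \<and> V \<subseteq> U \<and>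
        (\<forall>x\<in>V. \<forall>x'\<in>V. \<forall>y\<in>topspace Y. \<bar>f (x, y) - f (x', y)\<bar> \<le> \<epsilon>)"
  shows "Namioka_property X Y f"
proof -
  define small where "small \<epsilon> V \<longleftrightarrow> openin X V \<and>
    (\<forall>x\<in>V. \<forall>x'\<in>V. \<forall>y\<in>topspace Y. \<bar>f (x, y) - f (x', y)\<bar> \<le> \<epsilon>)" for \<epsilon> :: real and V
  define D where "D k = \<Union>{V. small (1 / real (Suc k)) V}" for k
  have op: "openin X (D k)" for k unfolding D_def small_def by auto
  have "X closure_of (D k) = topspace X" for k
    unfolding dense_intersects_open
  proof (intro allI impI)
    fix T assume "openin X T \<and> T \<noteq> {}"
    then obtain V where "V \<noteq> {}" "V \<subseteq> T" "small (1 / real (Suc k)) V"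
      using assms(3)[of T "1 / real (Suc k)"] unfolding small_def by auto
    then show "D k \<inter> T \<noteq> {}" unfolding D_def by blast
  qed
  with op X have dense: "X closure_of (\<Inter>k. D k) = topspace X"
    unfolding Baire_space_def by blast
  have gd: "gdelta_in X (\<Inter>k. D k)"
    by (rule gdelta_in_Inter) (use op open_imp_gdelta_in in auto)
  have "topcontinuous_at (prod_topology X Y) euclideanreal f (x, y)"
    if x: "x \<in> (\<Inter>k. D k)" and y: "y \<in> topspace Y" for x y
    unfolding topcontinuous_at_def
  proof (intro conjI allI impI)
    have xX: "x \<in> topspace X" using x op openin_subset by blast
    then show "(x, y) \<in> topspace (prod_topology X Y)" using y by simp
    show "f \<in> topspace (prod_topology X Y) \<rightarrow> topspace euclideanreal" by simp
    fix V assume V: "openin euclideanreal V \<and> f (x, y) \<in> V"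
    then obtain e where e: "e > 0" "ball (f (x, y)) e \<subseteq> V"
      using openE by (metis open_openin)
    obtain k where k: "1 / real (Suc k) < e / 2"
      using e(1) by (meson half_gt_zero nat_approx_posE)
    from x have "x \<in> D k" by blast
    then obtain W where W: "small (1 / real (Suc k)) W" "x \<in> W"
      unfolding D_def by blast
    from f xX have fx: "continuous_map Y euclideanreal (\<lambda>y. f (x, y))"
      by (simp add: separately_continuous_def)
    \<comment> \<open>\<open>N\<close> controls the move from \<open>y\<close> to \<open>y'\<close>
      along the fixed section at \<open>x\<close>; membership in \<open>W\<close> then controls the
      move from \<open>x\<close> to \<open>x'\<close> at \<open>y'\<close>. Each costs less than
      \<open>e / 2\<close>.\<close>
    define N where "N = {y' \<in> topspace Y. f (x, y') \<in> ball (f (x, y)) (e / 2)}"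
    have "openin Y N"
      unfolding N_def by (rule openin_continuous_map_preimage[OF fx]) simp
    then have "openin (prod_topology X Y) (W \<times> N)"
      using W unfolding small_def by (simp add: openin_prod_Times_iff)
    moreover have "(x, y) \<in> W \<times> N" using W y e unfolding N_def by simp
    moreover have "f p \<in> V" if p: "p \<in> W \<times> N" for p
    proof -
      from p obtain x' y' where p: "p = (x', y')" "x' \<in> W" "y' \<in> N" by auto
      have "\<bar>f (x', y') - f (x, y')\<bar> \<le> 1 / real (Suc k)"
        using W p by (auto simp: small_def N_def)
      moreover have "\<bar>f (x, y) - f (x, y')\<bar> < e / 2"
        using p unfolding N_def by (auto simp: dist_real_def)
      ultimately have "\<bar>f (x, y) - f (x', y')\<bar> < e" using k by linarith
      then have "f p \<in> ball (f (x, y)) e"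
        using p by (simp add: dist_real_def)
      then show ?thesis using e by auto
    qed
    ultimately show "\<exists>U. openin (prod_topology X Y) U \<and> (x, y) \<in> U \<and> (\<forall>y\<in>U. f y \<in> V)"
      by (intro exI[of _ "W \<times> N"]) auto
  qed
  then show ?thesis
    unfolding Namioka_property_def using gd dense by blast
qed

text \<open>If two values were more than \<open>card M * \<delta>\<close> apart, connectedness would
  supply \<open>card M + 1\<close> points with equally spaced values and gaps above
  \<open>\<delta>\<close>. By the pigeonhole principle two of them share a code, which contradicts
  \<open>le\<close>.\<close>

lemma connected_finite_fibres_diameter:
  fixes \<phi> :: "'b \<Rightarrow> real" and c :: "'b \<Rightarrow> 'c"
  assumes conn: "connected (\<phi> ` B)" and M: "finite M" "c ` B \<subseteq> M"
    and le: "\<And>a b. a \<in> B \<Longrightarrow> b \<in> B \<Longrightarrow> c a = c b \<Longrightarrow> \<bar>\<phi> a - \<phi> b\<bar> \<le> \<delta>"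
    and u: "u \<in> B" and v: "v \<in> B"
  shows "\<bar>\<phi> u - \<phi> v\<bar> \<le> real (card M) * \<delta>"
proof -
  have "\<phi> v - \<phi> u \<le> real (card M) * \<delta>" if uv: "u \<in> B" "v \<in> B" for u v
  proof (rule ccontr)
    assume "\<not> ?thesis"
    then have gt: "\<phi> v - \<phi> u > real (card M) * \<delta>" by simp
    define m where "m = card M"
    have m: "m > 0" unfolding m_def using M uv(1) by (auto simp: card_gt_0_iff)
    define s where "s = (\<phi> v - \<phi> u) / m"
    have s: "s > \<delta>" unfolding s_def using gt m by (simp add: m_def field_simps)
    have "\<delta> \<ge> 0" using le[OF u u] by simp
    \<comment> \<open>Both ends \<open>j = 0\<close> and \<open>j = m\<close> are included, so there
      is one point more than there are codes.\<close>
    have "\<exists>w\<in>B. \<phi> w = \<phi> u + real j * s" if "j \<le> m" for j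
    proof -
      have "real j * s \<le> real m * s"
        using that s \<open>\<delta> \<ge> 0\<close> by (intro mult_right_mono) auto
      moreover have "0 \<le> real j * s" using s \<open>\<delta> \<ge> 0\<close> by simp
      ultimately have "\<phi> u + real j * s \<in> {\<phi> u..\<phi> v}"
        using m by (auto simp: s_def)
      then have "\<phi> u + real j * s \<in> \<phi> ` B"
        using connected_contains_Icc[OF conn] uv by blast
      then show ?thesis by (metis imageE)
    qed
    then obtain w where w: "\<And>j. j \<le> m \<Longrightarrow> w j \<in> B \<and> \<phi> (w j) = \<phi> u + real j * s"
      by metis
    have "card ((c \<circ> w) ` {..m}) \<le> m"
      unfolding m_def using M w by (intro card_mono) (auto simp: m_def)
    then have "\<not> inj_on (c \<circ> w) {..m}"
      using card_image[of "c \<circ> w" "{..m}"] by auto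
    then obtain i' j' where ij': "i' \<le> m" "j' \<le> m" "i' \<noteq> j'" "c (w i') = c (w j')"
      unfolding inj_on_def by auto
    define i j where "i = min i' j'" and "j = max i' j'"
    have ij: "i \<le> m" "j \<le> m" "i < j" "c (w i) = c (w j)"
      using ij' unfolding i_def j_def by (auto simp: min_def max_def)
    then have "\<bar>\<phi> (w i) - \<phi> (w j)\<bar> \<le> \<delta>" using le w by blast
    moreover have "\<phi> (w j) - \<phi> (w i) = real (j - i) * s"
      using w ij by (simp add: of_nat_diff algebra_simps)
    moreover have "real (j - i) * s \<ge> 1 * s"
      using ij s \<open>\<delta> \<ge> 0\<close> by (intro mult_right_mono) auto
    ultimately show False using s by linarith
  qed
  from this[OF u v] this[OF v u] show ?thesis by (simp add: abs_le_iff)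
qed

subsection \<open>Cells of a linear order\<close>

definition less_in :: "'a rel \<Rightarrow> 'a \<Rightarrow> 'a \<Rightarrow> bool" where
  "less_in r a b \<longleftrightarrow> (a, b) \<in> r \<and> a \<noteq> b"

text \<open>The disjunct \<open>s = t\<close> covers the case of two points on the cut itself. For
  distinct points only strict inequalities remain, so the condition is open in the cut
  \<open>c\<close>.\<close>

definition same_side :: "'a rel \<Rightarrow> 'a \<Rightarrow> 'a \<Rightarrow> 'a \<Rightarrow> bool" where
  "same_side r c s t \<longleftrightarrow>
     s = t \<or> (less_in r s c \<and> less_in r t c) \<or> (less_in r c s \<and> less_in r c t)"

definition same_cell ::
  "(nat \<Rightarrow> 'a rel) \<Rightarrow> (nat \<times> 'a) set \<Rightarrow> (nat \<Rightarrow> 'a) \<Rightarrow> (nat \<Rightarrow> 'a) \<Rightarrow> bool" where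
  "same_cell r K u v \<longleftrightarrow> (\<forall>(i, c)\<in>K. same_side (r i) c (u i) (v i))"

text \<open>Strictness on both sides of \<open>h\<close> makes this an open condition on the pair
  \<open>a\<close>, \<open>b\<close>.\<close>

definition split_by :: "'a rel \<Rightarrow> 'a set \<Rightarrow> 'a \<Rightarrow> 'a \<Rightarrow> bool" where
  "split_by r H a b \<longleftrightarrow>
     (\<exists>h\<in>H. less_in r a h \<and> less_in r h b \<or> less_in r b h \<and> less_in r h a)"

lemma same_cell_mono: "same_cell r K u v \<Longrightarrow> K' \<subseteq> K \<Longrightarrow> same_cell r K' u v"
  unfolding same_cell_def by blast

lemma openin_product_preimage:
  assumes "k \<in> I" "openin (X k) U"
  shows "openin (product_topology X I) {x \<in> topspace (product_topology X I). x k \<in> U}"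
  using assms(1)
  by (intro openin_continuous_map_preimage[OF _ assms(2)] continuous_map_product_projection)

context
  fixes L :: "'a set" and r :: "'a rel"
  assumes lin: "linear_order_on L r"
begin

lemma rel_in: "(a, b) \<in> r \<Longrightarrow> a \<in> L \<and> b \<in> L"
  using lin unfolding linear_order_on_def partial_order_on_def preorder_on_def by auto

lemma rel_refl: "a \<in> L \<Longrightarrow> (a, a) \<in> r"
  using lin unfolding linear_order_on_def partial_order_on_def preorder_on_def refl_on_def by auto

lemma rel_trans: "(a, b) \<in> r \<Longrightarrow> (b, c) \<in> r \<Longrightarrow> (a, c) \<in> r"
  using lin unfolding linear_order_on_def partial_order_on_def preorder_on_def by (meson transE)

lemma rel_antisym: "(a, b) \<in> r \<Longrightarrow> (b, a) \<in> r \<Longrightarrow> a = b"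
  using lin unfolding linear_order_on_def partial_order_on_def by (meson antisymD)

lemma rel_total: "a \<in> L \<Longrightarrow> b \<in> L \<Longrightarrow> (a, b) \<in> r \<or> (b, a) \<in> r"
  using lin rel_refl unfolding linear_order_on_def total_on_def by metis

lemma less_in_cases: "a \<in> L \<Longrightarrow> b \<in> L \<Longrightarrow> less_in r a b \<or> a = b \<or> less_in r b a"
  unfolding less_in_def using rel_total by auto

lemma less_in_in: "less_in r a b \<Longrightarrow> a \<in> L \<and> b \<in> L"
  unfolding less_in_def using rel_in by auto

lemma less_in_asym: "less_in r a b \<Longrightarrow> \<not> less_in r b a"
  unfolding less_in_def using rel_antisym by auto

lemma less_in_le_trans: "less_in r a b \<Longrightarrow> (b, c) \<in> r \<Longrightarrow> less_in r a c"
  unfolding less_in_def using rel_antisym rel_trans by metis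

lemma le_less_in_trans: "(a, b) \<in> r \<Longrightarrow> less_in r b c \<Longrightarrow> less_in r a c"
  unfolding less_in_def using rel_antisym rel_trans by metis

lemma openin_less: "openin (order_topology_on L r) {t. less_in r t c}"
proof (cases "c \<in> L")
  case True
  have "{t. less_in r t c} = {t \<in> L. (t, c) \<in> r \<and> t \<noteq> c}"
    unfolding less_in_def using rel_in by auto
  then show ?thesis
    unfolding order_topology_on_def
    by (intro topology_generated_by_Basis) (use True in blast)
next
  case False
  then have "{t. less_in r t c} = {}" using less_in_in by blast
  then show ?thesis by simp
qed

lemma openin_greater: "openin (order_topology_on L r) {t. less_in r c t}"
proof (cases "c \<in> L")
  case True
  have "{t. less_in r c t} = {t \<in> L. (c, t) \<in> r \<and> c \<noteq> t}"
    unfolding less_in_def using rel_in by auto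
  then show ?thesis
    unfolding order_topology_on_def
    by (intro topology_generated_by_Basis) (use True in blast)
next
  case False
  then have "{t. less_in r c t} = {}" using less_in_in by blast
  then show ?thesis by simp
qed

text \<open>A subbasic ray is a union of cells of its endpoint, and a finite intersection collects
  the endpoints. For a union one member containing \<open>t\<close> is kept, since all members
  together could need infinitely many cuts; hence \<open>N\<close> may be smaller than
  \<open>U\<close>.\<close>

lemma order_topology_saturated_neighbourhood:
  assumes "openin (order_topology_on L r) U" "t \<in> U"
  shows "\<exists>C N. finite C \<and> C \<subseteq> L \<and> openin (order_topology_on L r) N \<and> t \<in> N \<and> N \<subseteq> U \<and>
    (\<forall>a\<in>N. \<forall>b\<in>L. (\<forall>c\<in>C. same_side r c a b) \<longrightarrow> b \<in> N)"
  using assms(1)[unfolded order_topology_on_def openin_topology_generated_by_iff] assms(2)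
proof (induction arbitrary: t)
  case Empty
  then show ?case by simp
next
  case (Int U V)
  obtain C N where N: "finite C" "C \<subseteq> L" "openin (order_topology_on L r) N" "t \<in> N" "N \<subseteq> U"
    "\<forall>a\<in>N. \<forall>b\<in>L. (\<forall>c\<in>C. same_side r c a b) \<longrightarrow> b \<in> N"
    using Int.IH(1)[of t] Int.prems by auto
  obtain C' N' where N': "finite C'" "C' \<subseteq> L" "openin (order_topology_on L r) N'" "t \<in> N'" "N' \<subseteq> V"
    "\<forall>a\<in>N'. \<forall>b\<in>L. (\<forall>c\<in>C'. same_side r c a b) \<longrightarrow> b \<in> N'"
    using Int.IH(2)[of t] Int.prems by auto
  show ?case
    by (rule exI[of _ "C \<union> C'"], rule exI[of _ "N \<inter> N'"]) (use N N' in \<open>auto intro: openin_Int\<close>)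
next
  case (UN K)
  then obtain k where k: "k \<in> K" "t \<in> k" by blast
  then obtain C N where N: "finite C" "C \<subseteq> L" "openin (order_topology_on L r) N" "t \<in> N" "N \<subseteq> k"
    "\<forall>a\<in>N. \<forall>b\<in>L. (\<forall>c\<in>C. same_side r c a b) \<longrightarrow> b \<in> N"
    using UN.IH[of k t] by auto
  show ?case
    by (rule exI[of _ C], rule exI[of _ N]) (use N k in auto)
next
  case (Basis s)
  then consider "s = L" | c where "c \<in> L" "s = {t. less_in r t c}"
    | c where "c \<in> L" "s = {t. less_in r c t}"
    unfolding less_in_def using rel_in by blast
  then show ?case
  proof cases
    case 1
    then show ?thesis using Basis.prems
      by (intro exI[of _ "{}"] exI[of _ L])
        (use openin_topspace[of "order_topology_on L r"] in auto)
  next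
    case 2
    then show ?thesis using Basis.prems openin_less[of c]
      by (intro exI[of _ "{c}"] exI[of _ s]) (auto simp: same_side_def dest: less_in_asym)
  next
    case 3
    then show ?thesis using Basis.prems openin_greater[of c]
      by (intro exI[of _ "{c}"] exI[of _ s]) (auto simp: same_side_def dest: less_in_asym)
  qed
qed

end

subsection \<open>Box-connected compact sets\<close>

locale box_connected_compact =
  fixes n :: nat and L :: "nat \<Rightarrow> 'a set" and r :: "nat \<Rightarrow> 'a rel" and Y :: "(nat \<Rightarrow> 'a) set"
  assumes lin: "i \<in> {1..n} \<Longrightarrow> linear_order_on (L i) (r i)"
    and compact: "compactin (product_topology (\<lambda>i. order_topology_on (L i) (r i)) {1..n}) Y"
    and box: "\<And>a b. a \<in> (\<Pi>\<^sub>E i\<in>{1..n}. L i) \<Longrightarrow> b \<in> (\<Pi>\<^sub>E i\<in>{1..n}. L i) \<Longrightarrow>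
      connectedin (product_topology (\<lambda>i. order_topology_on (L i) (r i)) {1..n})
        (Y \<inter> (\<Pi>\<^sub>E i\<in>{1..n}. order_interval (r i) (a i) (b i)))"
begin

abbreviation P :: "(nat \<Rightarrow> 'a) topology" where
  "P \<equiv> product_topology (\<lambda>i. order_topology_on (L i) (r i)) {1..n}"

text \<open>Cuts are later confined to these projections because they are compact, as images of
  \<open>Y\<close>, and have no gaps; neither is assumed of \<open>L i\<close>.\<close>

definition T :: "nat \<Rightarrow> 'a set" where
  "T i = (\<lambda>y. y i) ` Y"

lemma Y_subset: "Y \<subseteq> (\<Pi>\<^sub>E i\<in>{1..n}. L i)"
  using compactin_subset_topspace[OF compact] by simp

lemma topspace_Y: "topspace (subtopology P Y) = Y"
  using Y_subset by auto

lemma Y_in: "y \<in> Y \<Longrightarrow> i \<in> {1..n} \<Longrightarrow> y i \<in> L i"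
  using Y_subset by (auto simp: PiE_iff)

lemma T_subset: "i \<in> {1..n} \<Longrightarrow> T i \<subseteq> L i"
  unfolding T_def using Y_in by auto

lemma order_hull_connected:
  assumes u: "u \<in> Y" and v: "v \<in> Y"
  obtains B where "connectedin P B" "u \<in> B" "v \<in> B" "B \<subseteq> Y"
    "\<And>w i. w \<in> B \<Longrightarrow> i \<in> {1..n} \<Longrightarrow> (u i, w i) \<in> r i \<and> (w i, v i) \<in> r i \<or>
       (v i, w i) \<in> r i \<and> (w i, u i) \<in> r i"
proof -
  \<comment> \<open>The coordinates of \<open>u\<close> and \<open>v\<close> are sorted on each axis
    separately, as the two points need not be comparable coordinatewise in one direction.\<close>
  define a where "a = (\<lambda>i\<in>{1..n}. if (u i, v i) \<in> r i then u i else v i)"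
  define b where "b = (\<lambda>i\<in>{1..n}. if (u i, v i) \<in> r i then v i else u i)"
  define B where "B = Y \<inter> (\<Pi>\<^sub>E i\<in>{1..n}. order_interval (r i) (a i) (b i))"
  have "a \<in> (\<Pi>\<^sub>E i\<in>{1..n}. L i)" "b \<in> (\<Pi>\<^sub>E i\<in>{1..n}. L i)"
    unfolding a_def b_def using Y_in u v by auto
  then have "connectedin P B" unfolding B_def by (rule box)
  moreover have "u i \<in> order_interval (r i) (a i) (b i)" "v i \<in> order_interval (r i) (a i) (b i)"
    if i: "i \<in> {1..n}" for i
    using rel_refl[OF lin[OF i]] rel_total[OF lin[OF i]] Y_in[OF u i] Y_in[OF v i] i
    unfolding a_def b_def order_interval_def by auto
  then have "u \<in> B" "v \<in> B"
    using u v Y_subset unfolding B_def by (auto simp: PiE_iff)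
  moreover have "(u i, w i) \<in> r i \<and> (w i, v i) \<in> r i \<or> (v i, w i) \<in> r i \<and> (w i, u i) \<in> r i"
    if w: "w \<in> B" and i: "i \<in> {1..n}" for w i
  proof -
    have "w i \<in> order_interval (r i) (a i) (b i)"
      using w i unfolding B_def by (auto simp: PiE_iff)
    then show ?thesis
      using i unfolding a_def b_def order_interval_def by (auto split: if_splits)
  qed
  moreover have "B \<subseteq> Y" unfolding B_def by simp
  ultimately show ?thesis using that by blast
qed

lemma openin_P_less: "i \<in> {1..n} \<Longrightarrow> openin P {y \<in> topspace P. less_in (r i) (y i) c}"
  using openin_product_preimage[where X = "\<lambda>i. order_topology_on (L i) (r i)", OF _ openin_less[OF lin]]
  by simp

lemma openin_P_greater: "i \<in> {1..n} \<Longrightarrow> openin P {y \<in> topspace P. less_in (r i) c (y i)}"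
  using openin_product_preimage[where X = "\<lambda>i. order_topology_on (L i) (r i)", OF _ openin_greater[OF lin]]
  by simp

text \<open>
  The order hull of two points is connected, so \<open>Y\<close> cannot be disconnected by open half spaces; this
  gives both order convexity and order density of the projections \<open>T i\<close>.
\<close>

lemma connected_cut:
  assumes u: "u \<in> Y" and v: "v \<in> Y" and i: "i \<in> {1..n}"
    and "less_in (r i) (u i) c'" "less_in (r i) c (v i)"
    and cover: "\<And>y. y \<in> Y \<Longrightarrow> less_in (r i) (y i) c' \<or> less_in (r i) c (y i)"
  shows "\<exists>y\<in>Y. less_in (r i) (y i) c' \<and> less_in (r i) c (y i)"
proof (rule ccontr)
  assume no: "\<not> ?thesis"
  obtain B where B: "connectedin P B" "u \<in> B" "v \<in> B" "B \<subseteq> Y"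
    using order_hull_connected[OF u v] by metis
  let ?E1 = "{y \<in> topspace P. less_in (r i) (y i) c'}"
  let ?E2 = "{y \<in> topspace P. less_in (r i) c (y i)}"
  have YP: "Y \<subseteq> topspace P" using Y_subset by simp
  show False
  proof (rule connectedinD[OF B(1) openin_P_less[OF i, of c'] openin_P_greater[OF i, of c]])
    show "B \<subseteq> ?E1 \<union> ?E2" using B(4) YP cover by fast
    show "?E1 \<inter> ?E2 \<inter> B = {}" using B(4) no by fast
    show "?E1 \<inter> B \<noteq> {}" using B(2,4) YP assms(4) by fast
    show "?E2 \<inter> B \<noteq> {}" using B(3,4) YP assms(5) by fast
  qed
qed

lemma T_convex:
  assumes "u \<in> Y" "v \<in> Y" and i: "i \<in> {1..n}"
    and uc: "less_in (r i) (u i) c" and cv: "less_in (r i) c (v i)"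
  shows "c \<in> T i"
proof (rule ccontr)
  assume c: "c \<notin> T i"
  have "less_in (r i) (y i) c \<or> less_in (r i) c (y i)" if "y \<in> Y" for y
    using less_in_cases[OF lin[OF i] Y_in[OF that i], of c] less_in_in[OF lin[OF i] uc] c that
    unfolding T_def by auto
  then have "\<exists>y\<in>Y. less_in (r i) (y i) c \<and> less_in (r i) c (y i)"
    by (intro connected_cut[OF assms]) auto
  then show False using less_in_asym[OF lin[OF i]] by blast
qed

text \<open>If nothing lay strictly between, the half spaces below \<open>b\<close> and above
  \<open>a\<close> would be disjoint on \<open>Y\<close>, and they cover it. The points
  \<open>h\<close> obtained here later separate the cuts of a grid.\<close>

lemma T_dense:
  assumes i: "i \<in> {1..n}" and a: "a \<in> T i" and b: "b \<in> T i" and ab: "less_in (r i) a b"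
  shows "\<exists>h\<in>T i. less_in (r i) a h \<and> less_in (r i) h b"
proof -
  note l = lin[OF i]
  obtain u v where uv: "u \<in> Y" "v \<in> Y" "u i = a" "v i = b" using a b unfolding T_def by auto
  have "\<exists>y\<in>Y. less_in (r i) (y i) b \<and> less_in (r i) a (y i)"
  proof (rule connected_cut[OF uv(1,2) i])
    show "less_in (r i) (u i) b" "less_in (r i) a (v i)" using uv ab by auto
    fix y assume "y \<in> Y"
    then have "less_in (r i) (y i) b \<or> (b, y i) \<in> r i"
      using less_in_cases[OF l Y_in[OF _ i] T_subset[OF i, THEN subsetD, OF b], of y]
        rel_refl[OF l] Y_in[OF _ i] by (auto simp: less_in_def)
    then show "less_in (r i) (y i) b \<or> less_in (r i) a (y i)"
      using less_in_le_trans[OF l ab] by blast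
  qed
  then show ?thesis unfolding T_def by blast
qed

section \<open>Finite grids: existence and the oscillation bound\<close>

definition grid :: "((nat \<Rightarrow> 'a) \<Rightarrow> real) \<Rightarrow> real \<Rightarrow> (nat \<times> 'a) set \<Rightarrow> bool" where
  "grid \<phi> \<delta> K \<longleftrightarrow> (\<forall>u\<in>Y. \<forall>v\<in>Y. same_cell r K u v \<longrightarrow> \<bar>\<phi> u - \<phi> v\<bar> \<le> \<delta>)"

text \<open>Each point has a neighbourhood whose trace on \<open>Y\<close> is a union of cells of
  finitely many cuts and on which \<open>\<phi>\<close> stays within \<open>\<delta> / 2\<close> of
  its value at the point. Finitely many of these cover \<open>Y\<close>, and their cuts taken
  together form the grid.\<close>

lemma finite_grid_exists:
  assumes \<phi>: "continuous_map (subtopology P Y) euclideanreal \<phi>" and \<delta>: "\<delta> > 0"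
  shows "\<exists>K. finite K \<and> K \<subseteq> Sigma {1..n} T \<and> grid \<phi> \<delta> K"
proof -
  define good where "good y K M \<longleftrightarrow> finite K \<and> K \<subseteq> Sigma {1..n} T \<and> openin P M \<and> y \<in> M \<and>
      (\<forall>a\<in>M \<inter> Y. \<forall>b\<in>Y. same_cell r K a b \<longrightarrow> b \<in> M) \<and>
      (\<forall>a\<in>M \<inter> Y. \<bar>\<phi> a - \<phi> y\<bar> < \<delta> / 2)" for y K M
  have "\<forall>y\<in>Y. \<exists>K M. good y K M"
  proof
    fix y assume y: "y \<in> Y"
    have "openin (subtopology P Y)
        {a \<in> topspace (subtopology P Y). \<phi> a \<in> ball (\<phi> y) (\<delta> / 2)}"
      by (rule openin_continuous_map_preimage[OF \<phi>]) simp
    then obtain W where W: "openin P W"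
      "{a \<in> topspace (subtopology P Y). \<phi> a \<in> ball (\<phi> y) (\<delta> / 2)} = W \<inter> Y"
      unfolding openin_subtopology by blast
    have "y \<in> topspace (subtopology P Y)" using y Y_subset by auto
    then have "y \<in> W" using W(2) \<delta> by auto
    then obtain U where U: "y \<in> Pi\<^sub>E {1..n} U" "\<And>i. openin (order_topology_on (L i) (r i)) (U i)"
      "Pi\<^sub>E {1..n} U \<subseteq> W"
      using product_topology_open_contains_basis[OF W(1)] by metis
    have "\<forall>i\<in>{1..n}. \<exists>C N. finite C \<and> C \<subseteq> L i \<and> openin (order_topology_on (L i) (r i)) N \<and>
        y i \<in> N \<and> N \<subseteq> U i \<and> (\<forall>a\<in>N. \<forall>b\<in>L i. (\<forall>c\<in>C. same_side (r i) c a b) \<longrightarrow> b \<in> N)"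
    proof
      fix i assume i: "i \<in> {1..n}"
      then have "y i \<in> U i" using U(1) by (auto simp: PiE_iff)
      then show "\<exists>C N. finite C \<and> C \<subseteq> L i \<and> openin (order_topology_on (L i) (r i)) N \<and>
        y i \<in> N \<and> N \<subseteq> U i \<and> (\<forall>a\<in>N. \<forall>b\<in>L i. (\<forall>c\<in>C. same_side (r i) c a b) \<longrightarrow> b \<in> N)"
        by (rule order_topology_saturated_neighbourhood[OF lin[OF i] U(2)])
    qed
    then obtain C N where CN: "\<forall>i\<in>{1..n}. finite (C i) \<and> C i \<subseteq> L i \<and>
        openin (order_topology_on (L i) (r i)) (N i) \<and> y i \<in> N i \<and> N i \<subseteq> U i \<and>
        (\<forall>a\<in>N i. \<forall>b\<in>L i. (\<forall>c\<in>C i. same_side (r i) c a b) \<longrightarrow> b \<in> N i)"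
      by metis
    then have C: "\<And>i. i \<in> {1..n} \<Longrightarrow> finite (C i)"
      and CL: "\<And>i. i \<in> {1..n} \<Longrightarrow> C i \<subseteq> L i"
      and N: "\<And>i. i \<in> {1..n} \<Longrightarrow> openin (order_topology_on (L i) (r i)) (N i)"
        "\<And>i. i \<in> {1..n} \<Longrightarrow> y i \<in> N i" "\<And>i. i \<in> {1..n} \<Longrightarrow> N i \<subseteq> U i"
      by auto
    have sat: "\<And>i a b. i \<in> {1..n} \<Longrightarrow> a \<in> N i \<Longrightarrow> b \<in> L i \<Longrightarrow>
        (\<And>c. c \<in> C i \<Longrightarrow> same_side (r i) c a b) \<Longrightarrow> b \<in> N i"
      using CN by blast
    \<comment> \<open>Only cuts in \<open>T i\<close> are kept. Saturation survives, because by
      \<open>T_convex\<close> a cut outside \<open>T i\<close> has all of \<open>Y\<close> on one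
      side.\<close>
    define K where "K = Sigma {1..n} (\<lambda>i. C i \<inter> T i)"
    have fin: "finite K" unfolding K_def using C by auto
    have KT: "K \<subseteq> Sigma {1..n} T" unfolding K_def by auto
    have op: "openin P (Pi\<^sub>E {1..n} N)"
      using N(1) by (simp add: openin_PiE_gen)
    have yN: "y \<in> Pi\<^sub>E {1..n} N"
      using N(2) Y_subset y by (auto simp: PiE_iff)
    have inv: "b \<in> Pi\<^sub>E {1..n} N"
      if a: "a \<in> Pi\<^sub>E {1..n} N \<inter> Y" and b: "b \<in> Y" and ab: "same_cell r K a b" for a b
    proof -
      have "b i \<in> N i" if i: "i \<in> {1..n}" for i
      proof (rule sat[OF i _ Y_in[OF b i]])
        show "a i \<in> N i" using a i by (auto simp: PiE_iff)
        fix c assume c: "c \<in> C i"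
        then have cL: "c \<in> L i" using CL[OF i] by blast
        have aY: "a \<in> Y" using a by simp
        show "same_side (r i) c (a i) (b i)"
        proof (cases "c \<in> T i")
          case True
          then show ?thesis using ab c i unfolding same_cell_def K_def by auto
        next
          case False
          then have "a i \<noteq> c" "b i \<noteq> c" using aY b unfolding T_def by auto
          then show ?thesis
            using less_in_cases[OF lin[OF i] Y_in[OF aY i] cL]
              less_in_cases[OF lin[OF i] Y_in[OF b i] cL]
              T_convex[OF aY b i, of c] T_convex[OF b aY i, of c] False
            unfolding same_side_def by blast
        qed
      qed
      then show ?thesis using b Y_subset by (auto simp: PiE_iff)
    qed
    have small: "\<bar>\<phi> a - \<phi> y\<bar> < \<delta> / 2" if a: "a \<in> Pi\<^sub>E {1..n} N \<inter> Y" for a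
    proof -
      have "a \<in> Pi\<^sub>E {1..n} U"
        using a N(3) PiE_mono[of "{1..n}" N U] by blast
      then have "a \<in> W \<inter> Y" using a U(3) by blast
      then have "\<phi> a \<in> ball (\<phi> y) (\<delta> / 2)" using W(2) by blast
      then show ?thesis by (simp add: dist_real_def abs_minus_commute)
    qed
    show "\<exists>K M. good y K M"
      unfolding good_def
      by (rule exI[of _ K], rule exI[of _ "Pi\<^sub>E {1..n} N"])
        (intro conjI ballI impI fin KT op yN inv small)
  qed
  then obtain K M where KM: "\<forall>y\<in>Y. good y (K y) (M y)" by metis
  then have K: "\<And>y. y \<in> Y \<Longrightarrow> finite (K y)" "\<And>y. y \<in> Y \<Longrightarrow> K y \<subseteq> Sigma {1..n} T"
    and M: "\<And>y. y \<in> Y \<Longrightarrow> openin P (M y)" "\<And>y. y \<in> Y \<Longrightarrow> y \<in> M y"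
      "\<And>y a b. y \<in> Y \<Longrightarrow> a \<in> M y \<inter> Y \<Longrightarrow> b \<in> Y \<Longrightarrow> same_cell r (K y) a b \<Longrightarrow> b \<in> M y"
      "\<And>y a. y \<in> Y \<Longrightarrow> a \<in> M y \<inter> Y \<Longrightarrow> \<bar>\<phi> a - \<phi> y\<bar> < \<delta> / 2"
    unfolding good_def by blast+
  have "\<exists>\<F>. finite \<F> \<and> \<F> \<subseteq> M ` Y \<and> Y \<subseteq> \<Union>\<F>"
    by (rule compactinD[OF compact]) (use M(1,2) in auto)
  then obtain D where D: "finite D" "D \<subseteq> Y" "Y \<subseteq> \<Union>(M ` D)"
    by (metis finite_subset_image)
  have "grid \<phi> \<delta> (\<Union>(K ` D))"
    unfolding grid_def
  proof (intro ballI impI)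
    fix u v assume u: "u \<in> Y" and v: "v \<in> Y" and uv: "same_cell r (\<Union>(K ` D)) u v"
    obtain d where d: "d \<in> D" "u \<in> M d" using u D(3) by blast
    have "same_cell r (K d) u v" by (rule same_cell_mono[OF uv]) (use d in blast)
    then have "v \<in> M d" using M(3)[of d u v] d u v D(2) by blast
    then have "\<bar>\<phi> u - \<phi> d\<bar> < \<delta> / 2" "\<bar>\<phi> v - \<phi> d\<bar> < \<delta> / 2"
      using M(4)[of d u] M(4)[of d v] d u v D(2) by blast+
    then show "\<bar>\<phi> u - \<phi> v\<bar> \<le> \<delta>" by linarith
  qed
  moreover have "finite (\<Union>(K ` D))" using D K(1) by blast
  moreover have "\<Union>(K ` D) \<subseteq> Sigma {1..n} T" using D K(2) by blast
  ultimately show ?thesis by blast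
qed

text \<open>On each axis at most one cut of \<open>K\<close> lies between \<open>u i\<close> and
  \<open>v i\<close>. Position below, on or above that cut therefore determines the cell of
  \<open>K\<close> for every point of the connected order hull of \<open>u\<close> and
  \<open>v\<close>. At most \<open>3 ^ n\<close> codes occur, so the pigeonhole bound for connected
  sets applies.\<close>

lemma oscillation_in_separated_cell:
  assumes \<phi>: "continuous_map (subtopology P Y) euclideanreal \<phi>"
    and K: "K \<subseteq> Sigma {1..n} L" "grid \<phi> \<delta> K"
    and sep: "\<And>i c c'. (i, c) \<in> K \<Longrightarrow> (i, c') \<in> K \<Longrightarrow> c \<noteq> c' \<Longrightarrow>
      split_by (r i) (H `` {i}) c c'"
    and u: "u \<in> Y" and v: "v \<in> Y" and uv: "same_cell r H u v"
  shows "\<bar>\<phi> u - \<phi> v\<bar> \<le> 3 ^ n * \<delta>"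
proof -
  obtain B where B: "connectedin P B" "u \<in> B" "v \<in> B" "B \<subseteq> Y"
    and hull: "\<And>w i. w \<in> B \<Longrightarrow> i \<in> {1..n} \<Longrightarrow> (u i, w i) \<in> r i \<and> (w i, v i) \<in> r i \<or>
       (v i, w i) \<in> r i \<and> (w i, u i) \<in> r i"
    by (rule order_hull_connected[OF u v]) (assumption | blast)+
  define between where "between i c \<longleftrightarrow> (u i, c) \<in> r i \<and> (c, v i) \<in> r i \<or>
       (v i, c) \<in> r i \<and> (c, u i) \<in> r i" for i c
  \<comment> \<open>Two such cuts would have a point \<open>h\<close> of \<open>H\<close> strictly
    between them, which would then lie strictly between \<open>u i\<close> and \<open>v i\<close>
    although these are on the same side of \<open>h\<close>.\<close>
  have unique: "c = c'"
    if c: "(i, c) \<in> K" "(i, c') \<in> K" "between i c" "between i c'" for i c c'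
  proof (rule ccontr)
    assume "c \<noteq> c'"
    have i: "i \<in> {1..n}" using c K(1) by blast
    note l = lin[OF i]
    obtain h where h: "(i, h) \<in> H"
      "less_in (r i) c h \<and> less_in (r i) h c' \<or> less_in (r i) c' h \<and> less_in (r i) h c"
      using sep[OF c(1,2) \<open>c \<noteq> c'\<close>] unfolding split_by_def by blast
    have "less_in (r i) (u i) h \<and> less_in (r i) h (v i) \<or>
        less_in (r i) (v i) h \<and> less_in (r i) h (u i)"
      using h(2) c(3,4) less_in_le_trans[OF l] le_less_in_trans[OF l] less_in_asym[OF l]
      unfolding between_def by meson
    moreover have "same_side (r i) h (u i) (v i)" using uv h(1) unfolding same_cell_def by blast
    ultimately show False
      unfolding same_side_def using less_in_asym[OF l] by metis
  qed
  \<comment> \<open>The value 1 means that \<open>w i\<close> is on the cut, and it is also the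
    default on an axis without a cut between \<open>u i\<close> and \<open>v i\<close>.\<close>
  define val where "val w i =
      (if \<exists>c. (i, c) \<in> K \<and> between i c \<and> less_in (r i) (w i) c then 0
       else if \<exists>c. (i, c) \<in> K \<and> between i c \<and> less_in (r i) c (w i) then 2 else 1 :: nat)" for w i
  have val: "val w i \<in> {0, 1, 2}" for w i unfolding val_def by simp
  define code where "code w = restrict (val w) {1..n}" for w
  let ?M = "{1..n} \<rightarrow>\<^sub>E {0, 1, 2::nat}"
  have "\<bar>\<phi> u - \<phi> v\<bar> \<le> real (card ?M) * \<delta>"
  proof (rule connected_finite_fibres_diameter[where B = B and c = code])
    have "connectedin (subtopology P Y) B" using B by (simp add: connectedin_subtopology)
    then have "connectedin euclideanreal (\<phi> ` B)" by (rule connectedin_continuous_map_image[OF \<phi>])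
    then show "connected (\<phi> ` B)" by simp
    show "finite ?M" by (intro finite_PiE) auto
    show "code ` B \<subseteq> ?M" unfolding code_def using val by (intro image_subsetI restrict_PiE_iff[THEN iffD2]) blast
    show "u \<in> B" by (rule B(2))
    show "v \<in> B" by (rule B(3))
    fix a b assume a: "a \<in> B" and b: "b \<in> B" and ab: "code a = code b"
    have "same_side (r i) c (a i) (b i)" if c: "(i, c) \<in> K" for i c
    proof -
      have i: "i \<in> {1..n}" and cL: "c \<in> L i" using c K(1) by auto
      note l = lin[OF i]
      have aL: "a i \<in> L i" and bL: "b i \<in> L i" using a b B(4) Y_in[OF _ i] by auto
      have uL: "u i \<in> L i" and vL: "v i \<in> L i" using Y_in[OF _ i] u v by auto
      note ca = less_in_cases[OF l aL cL] and cb = less_in_cases[OF l bL cL]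
      show ?thesis
      proof (cases "between i c")
        case True
        have eq: "(\<exists>c'. (i, c') \<in> K \<and> between i c' \<and> Q c') \<longleftrightarrow> Q c" for Q
          using True c unique by blast
        have val_eq: "val w i = (if less_in (r i) (w i) c then 0 else if less_in (r i) c (w i) then 2 else 1)"
          for w unfolding val_def eq by simp
        have "val a i = val b i" using fun_cong[OF ab, of i] i unfolding code_def by simp
        then show ?thesis
          using ca cb less_in_asym[OF l] unfolding same_side_def val_eq by (auto split: if_splits)
      next
        case False
        \<comment> \<open>A cut not between \<open>u i\<close> and \<open>v i\<close> has both of
          them, and hence the whole hull, on one side.\<close>
        have "(c, w i) \<in> r i \<longleftrightarrow> (c, u i) \<in> r i \<and> (c, v i) \<in> r i" if w: "w \<in> B" for w
          using hull[OF w i] False rel_trans[OF l] rel_total[OF l cL uL] rel_total[OF l cL vL]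
          unfolding between_def by meson
        then have "(c, a i) \<in> r i \<longleftrightarrow> (c, b i) \<in> r i" using a b by blast
        moreover have "a i \<noteq> c" "b i \<noteq> c"
          using hull[OF a i] hull[OF b i] False unfolding between_def by auto
        ultimately show ?thesis
          using ca cb unfolding same_side_def less_in_def by auto
      qed
    qed
    then have "same_cell r K a b" unfolding same_cell_def by blast
    then show "\<bar>\<phi> a - \<phi> b\<bar> \<le> \<delta>" using K(2) a b B(4) unfolding grid_def by blast
  qed
  also have "card ?M = 3 ^ n" by (simp add: card_PiE numeral_3_eq_3)
  finally show ?thesis by simp
qed

text \<open>The cell of a point is determined by which cuts in \<open>H\<close> lie strictly above
  it and which strictly below it, a pair of subsets of the finite set \<open>H\<close>.\<close>

lemma finite_cell_representatives:
  assumes "finite H" and H: "H \<subseteq> Sigma {1..n} L"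
  shows "\<exists>D. finite D \<and> D \<subseteq> Y \<and> (\<forall>y\<in>Y. \<exists>d\<in>D. same_cell r H y d)"
proof -
  define code where "code y =
    ({p\<in>H. less_in (r (fst p)) (y (fst p)) (snd p)}, {p\<in>H. less_in (r (fst p)) (snd p) (y (fst p))})"
    for y
  have "code ` Y \<subseteq> Pow H \<times> Pow H" unfolding code_def by auto
  then have "finite (code ` Y)" using assms(1) finite_subset by blast
  then obtain D where D: "D \<subseteq> Y" "finite D" "code ` Y = code ` D"
    using finite_subset_image[of "code ` Y" code Y] by auto
  have "\<exists>d\<in>D. same_cell r H y d" if y: "y \<in> Y" for y
  proof -
    obtain d where d: "d \<in> D" "code y = code d" using D(3) y by (metis imageE imageI)
    have "same_side (r i) c (y i) (d i)" if c: "(i, c) \<in> H" for i c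
    proof -
      have i: "i \<in> {1..n}" and cL: "c \<in> L i" using c H by auto
      have "d \<in> Y" using d D by blast
      have "less_in (r i) (y i) c = less_in (r i) (d i) c"
        using arg_cong[OF d(2), of "\<lambda>s. (i, c) \<in> fst s"] c unfolding code_def by simp
      moreover have "less_in (r i) c (y i) = less_in (r i) c (d i)"
        using arg_cong[OF d(2), of "\<lambda>s. (i, c) \<in> snd s"] c unfolding code_def by simp
      ultimately show ?thesis
        using less_in_cases[OF lin[OF i] Y_in[OF y i] cL]
          less_in_cases[OF lin[OF i] Y_in[OF \<open>d \<in> Y\<close> i] cL]
        unfolding same_side_def by auto
    qed
    then show ?thesis using d(1) unfolding same_cell_def by blast
  qed
  then show ?thesis using D by blast
qed

subsection \<open>The compact space of cuts of a given shape\<close>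

text \<open>
  A shape is a finite set of labels \<open>(i, k)\<close>; the label \<open>(i, k)\<close> carries a cut on axis \<open>i\<close>, and \<open>k\<close> only
  distinguishes the cuts on that axis.
\<close>

definition cut_space :: "(nat \<times> nat) set \<Rightarrow> (nat \<times> nat \<Rightarrow> 'a) topology" where
  "cut_space I =
     product_topology (\<lambda>p. subtopology (order_topology_on (L (fst p)) (r (fst p))) (T (fst p))) I"

definition cuts :: "(nat \<times> nat) set \<Rightarrow> (nat \<times> nat \<Rightarrow> 'a) \<Rightarrow> (nat \<times> 'a) set" where
  "cuts I g = (\<lambda>p. (fst p, g p)) ` I"

text \<open>Labels are natural numbers rather than points of the axes so that there are only
  countably many shapes, as the category argument requires.\<close>

definition index_sets :: "(nat \<times> nat) set set" where
  "index_sets = {I. finite I \<and> I \<subseteq> {1..n} \<times> UNIV}"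

lemma index_fst: "I \<in> index_sets \<Longrightarrow> p \<in> I \<Longrightarrow> fst p \<in> {1..n}"
  unfolding index_sets_def by auto

lemma topspace_cut_space:
  assumes "I \<in> index_sets"
  shows "topspace (cut_space I) = (\<Pi>\<^sub>E p\<in>I. T (fst p))"
  unfolding cut_space_def using T_subset index_fst[OF assms]
  by (auto intro!: PiE_cong simp: Int_absorb1)

text \<open>Each \<open>T i\<close> is compact as a continuous image of \<open>Y\<close>, so
  Tychonoff's theorem applies.\<close>

lemma compact_cut_space:
  assumes "I \<in> index_sets"
  shows "compact_space (cut_space I)"
proof -
  have "compact_space (subtopology (order_topology_on (L (fst p)) (r (fst p))) (T (fst p)))"
    if p: "p \<in> I" for p
  proof (rule compact_space_subtopology)
    show "compactin (order_topology_on (L (fst p)) (r (fst p))) (T (fst p))"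
      unfolding T_def
      by (rule image_compactin[OF compact])
        (rule continuous_map_product_projection[OF index_fst[OF assms p]])
  qed
  then show ?thesis unfolding cut_space_def by (simp add: compact_space_product_topology)
qed

lemma openin_cut_space:
  assumes "p \<in> I" "openin (order_topology_on (L (fst p)) (r (fst p))) U"
  shows "openin (cut_space I) {g \<in> topspace (cut_space I). g p \<in> U}"
proof -
  have "openin (cut_space I) {g \<in> topspace (cut_space I). g p \<in> U \<inter> T (fst p)}"
    unfolding cut_space_def
    by (rule openin_product_preimage[OF assms(1)]) (use assms(2) openin_subtopology in blast)
  also have "{g \<in> topspace (cut_space I). g p \<in> U \<inter> T (fst p)} = {g \<in> topspace (cut_space I). g p \<in> U}"
    unfolding cut_space_def using assms(1) by (auto simp: PiE_iff)
  finally show ?thesis .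
qed

text \<open>A coordinate on which \<open>u\<close> and \<open>v\<close> agree imposes no condition
  on \<open>g\<close>; on any other the cut must lie strictly above both or strictly below both.
  This openness is what makes the grid condition closed.\<close>

lemma openin_same_cell:
  assumes I: "I \<in> index_sets"
  shows "openin (cut_space I) {g \<in> topspace (cut_space I). same_cell r (cuts I g) u v}"
proof -
  let ?Q = "topspace (cut_space I)"
  define E where "E p = {g \<in> ?Q. same_side (r (fst p)) (g p) (u (fst p)) (v (fst p))}" for p
  have "openin (cut_space I) (E p)" if p: "p \<in> I" for p
  proof (cases "u (fst p) = v (fst p)")
    case True
    then have "E p = ?Q" unfolding E_def same_side_def by auto
    then show ?thesis by simp
  next
    case False
    note l = lin[OF index_fst[OF I p]]
    have "E p = ({g \<in> ?Q. g p \<in> {c. less_in (r (fst p)) (u (fst p)) c}} \<inter>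
                 {g \<in> ?Q. g p \<in> {c. less_in (r (fst p)) (v (fst p)) c}}) \<union>
                ({g \<in> ?Q. g p \<in> {c. less_in (r (fst p)) c (u (fst p))}} \<inter>
                 {g \<in> ?Q. g p \<in> {c. less_in (r (fst p)) c (v (fst p))}})"
      unfolding E_def same_side_def using False by auto
    moreover have "openin (cut_space I) \<dots>"
      by (intro openin_Un openin_Int openin_cut_space[OF p] openin_less[OF l] openin_greater[OF l])
    ultimately show ?thesis by simp
  qed
  then have "openin (cut_space I) ((\<Inter>p\<in>I. E p) \<inter> ?Q)"
    using I unfolding index_sets_def by (intro openin_INT) auto
  also have "(\<Inter>p\<in>I. E p) \<inter> ?Q = {g \<in> ?Q. same_cell r (cuts I g) u v}"
    unfolding E_def same_cell_def cuts_def by auto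
  finally show ?thesis .
qed

section \<open>Separating the cuts on a common axis by finitely many points\<close>

definition separated :: "(nat \<times> nat) set \<Rightarrow> (nat \<times> 'a) set \<Rightarrow> (nat \<times> nat \<Rightarrow> 'a) \<Rightarrow> bool" where
  "separated I H g \<longleftrightarrow> (\<forall>p\<in>I. \<forall>q\<in>I. p \<noteq> q \<longrightarrow> fst p = fst q \<longrightarrow>
     split_by (r (fst p)) (H `` {fst p}) (g p) (g q))"

lemma separated_mono: "separated I H g \<Longrightarrow> H \<subseteq> H' \<Longrightarrow> separated I H' g"
  unfolding separated_def split_by_def by blast

lemma openin_separated:
  assumes I: "I \<in> index_sets"
  shows "openin (cut_space I) {g \<in> topspace (cut_space I). separated I H g}"
proof -
  let ?Q = "topspace (cut_space I)"
  define E where "E p q = {g \<in> ?Q. split_by (r (fst p)) (H `` {fst p}) (g p) (g q)}" for p q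
  define J where "J = {(p, q). p \<in> I \<and> q \<in> I \<and> p \<noteq> q \<and> fst p = fst q}"
  have "openin (cut_space I) (E p q)" if pq: "p \<in> I" "q \<in> I" "fst p = fst q" for p q
  proof -
    note l = lin[OF index_fst[OF I pq(1)]] and l' = lin[OF index_fst[OF I pq(2)]]
    define F where "F h = ({g \<in> ?Q. g p \<in> {c. less_in (r (fst p)) c h}} \<inter>
                 {g \<in> ?Q. g q \<in> {c. less_in (r (fst q)) h c}}) \<union>
                ({g \<in> ?Q. g q \<in> {c. less_in (r (fst q)) c h}} \<inter>
                 {g \<in> ?Q. g p \<in> {c. less_in (r (fst p)) h c}})" for h
    have "openin (cut_space I) (F h)" for h
      unfolding F_def
      by (intro openin_Un openin_Int openin_cut_space[OF pq(1)] openin_cut_space[OF pq(2)]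
          openin_less[OF l] openin_greater[OF l] openin_less[OF l'] openin_greater[OF l'])
    then have "openin (cut_space I) (\<Union>(F ` (H `` {fst p})))" by blast
    also have "\<Union>(F ` (H `` {fst p})) = E p q"
      unfolding E_def F_def split_by_def using pq(3) by auto
    finally show ?thesis .
  qed
  moreover have "finite J"
    using I unfolding index_sets_def J_def by (auto intro: finite_subset[of _ "I \<times> I"])
  ultimately have "openin (cut_space I) ((\<Inter>j\<in>J. E (fst j) (snd j)) \<inter> ?Q)"
    by (intro openin_INT) (auto simp: J_def)
  also have "(\<Inter>j\<in>J. E (fst j) (snd j)) \<inter> ?Q = {g \<in> ?Q. separated I H g}"
    unfolding E_def separated_def J_def by fastforce
  finally show ?thesis .
qed

text \<open>Order density of \<open>T i\<close> gives one separating point for each of the finitely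
  many pairs of labels on the same axis.\<close>

lemma separated_exists:
  assumes I: "I \<in> index_sets" and g: "g \<in> topspace (cut_space I)"
    and ne: "\<And>p q. p \<in> I \<Longrightarrow> q \<in> I \<Longrightarrow> p \<noteq> q \<Longrightarrow> fst p = fst q \<Longrightarrow> g p \<noteq> g q"
  shows "\<exists>H. finite H \<and> H \<subseteq> Sigma {1..n} T \<and> separated I H g"
proof -
  define J where "J = {(p, q). p \<in> I \<and> q \<in> I \<and> p \<noteq> q \<and> fst p = fst q}"
  have "finite J"
    using I unfolding index_sets_def J_def by (auto intro: finite_subset[of _ "I \<times> I"])
  have "\<exists>h. h \<in> T (fst p) \<and> split_by (r (fst p)) {h} (g p) (g q)" if "(p, q) \<in> J" for p q
  proof -
    have j: "p \<in> I" "q \<in> I" "p \<noteq> q" "fst p = fst q"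
      using that unfolding J_def by auto
    have i: "fst p \<in> {1..n}" using index_fst[OF I j(1)] .
    have gT: "g p \<in> T (fst p)" "g q \<in> T (fst p)"
      using g j unfolding topspace_cut_space[OF I] by (auto simp: PiE_iff)
    have "less_in (r (fst p)) (g p) (g q) \<or> less_in (r (fst p)) (g q) (g p)"
      using less_in_cases[OF lin[OF i]] gT T_subset[OF i] ne[OF j] by blast
    then show ?thesis
      using T_dense[OF i gT] T_dense[OF i gT(2,1)] unfolding split_by_def by auto
  qed
  then obtain h where h: "\<And>p q. (p, q) \<in> J \<Longrightarrow> h p q \<in> T (fst p)"
    "\<And>p q. (p, q) \<in> J \<Longrightarrow> split_by (r (fst p)) {h p q} (g p) (g q)"
    by metis
  let ?H = "(\<lambda>(p, q). (fst p, h p q)) ` J"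
  have "?H \<subseteq> Sigma {1..n} T" using h(1) index_fst[OF I] by (auto simp: J_def) blast
  moreover have "separated I ?H g"
    unfolding separated_def
  proof (intro ballI impI)
    fix p q assume "p \<in> I" "q \<in> I" "p \<noteq> q" "fst p = fst q"
    then have "(p, q) \<in> J" unfolding J_def by simp
    then have "(fst p, h p q) \<in> ?H" by force
    then have "h p q \<in> ?H `` {fst p}" by blast
    then show "split_by (r (fst p)) (?H `` {fst p}) (g p) (g q)"
      using h(2)[OF \<open>(p, q) \<in> J\<close>] unfolding split_by_def by blast
  qed
  ultimately show ?thesis using \<open>finite J\<close> by blast
qed

subsection \<open>Minimal grids\<close>

text \<open>The grid is kept beside the point: this set is closed in a product with a compact
  factor, so its first projection, the set of points having a grid of shape \<open>I\<close>, is
  closed as well.\<close>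

definition grid_pairs ::
  "'x topology \<Rightarrow> ('x \<times> (nat \<Rightarrow> 'a) \<Rightarrow> real) \<Rightarrow> real \<Rightarrow> (nat \<times> nat) set \<Rightarrow>
     ('x \<times> (nat \<times> nat \<Rightarrow> 'a)) set" where
  "grid_pairs X f \<delta> I = {(x, g). x \<in> topspace X \<and> g \<in> topspace (cut_space I) \<and>
     grid (\<lambda>y. f (x, y)) \<delta> (cuts I g)}"

text \<open>A pair fails exactly when some \<open>u\<close>, \<open>v\<close> in \<open>Y\<close>
  share a cell of the grid although f differs by more than \<open>\<delta>\<close> at them. The
  complement is thus a union of open boxes, with continuity of f in x giving the first side.\<close>

lemma closedin_grid_pairs:
  assumes f: "separately_continuous X (subtopology P Y) f" and I: "I \<in> index_sets"
  shows "closedin (prod_topology X (cut_space I)) (grid_pairs X f \<delta> I)"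
proof -
  let ?XQ = "prod_topology X (cut_space I)"
  define A where "A u v = {x \<in> topspace X. f (x, u) - f (x, v) \<in> - cball 0 \<delta>}" for u v
  define B where "B u v = {g \<in> topspace (cut_space I). same_cell r (cuts I g) u v}" for u v
  have "openin X (A u v)" if "u \<in> Y" "v \<in> Y" for u v
  proof -
    have "continuous_map X euclideanreal (\<lambda>x. f (x, u) - f (x, v))"
      using f that topspace_Y unfolding separately_continuous_def
      by (intro continuous_map_diff) blast+
    then show ?thesis
      unfolding A_def by (rule openin_continuous_map_preimage) (simp add: open_Compl)
  qed
  then have "openin ?XQ (\<Union>u\<in>Y. \<Union>v\<in>Y. A u v \<times> B u v)"
    using openin_same_cell[OF I] unfolding B_def
    by (intro openin_Union) (auto simp: openin_prod_Times_iff)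
  moreover have "topspace ?XQ - grid_pairs X f \<delta> I = (\<Union>u\<in>Y. \<Union>v\<in>Y. A u v \<times> B u v)"
    unfolding grid_pairs_def grid_def A_def B_def by auto
  moreover have "grid_pairs X f \<delta> I \<subseteq> topspace ?XQ" unfolding grid_pairs_def by auto
  ultimately show ?thesis by (simp add: closedin_def)
qed

lemma closedin_fst_image:
  assumes "I \<in> index_sets" "closedin (prod_topology X (cut_space I)) S"
  shows "closedin X (fst ` S)"
  using closed_map_fst[OF compact_cut_space[OF assms(1)]] assms(2) unfolding closed_map_def by blast

lemma grid_pairs_cover:
  assumes f: "separately_continuous X (subtopology P Y) f" and "\<delta> > 0" and x: "x \<in> topspace X"
  shows "\<exists>I\<in>index_sets. x \<in> fst ` grid_pairs X f \<delta> I"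
proof -
  have "continuous_map (subtopology P Y) euclideanreal (\<lambda>y. f (x, y))"
    using f x unfolding separately_continuous_def by blast
  then obtain K where K: "finite K" "K \<subseteq> Sigma {1..n} T" "grid (\<lambda>y. f (x, y)) \<delta> K"
    using finite_grid_exists \<open>\<delta> > 0\<close> by metis
  \<comment> \<open>The injection relabels the cuts by natural numbers, and \<open>g\<close> reads
    the cut back off its label.\<close>
  obtain e :: "nat \<times> 'a \<Rightarrow> nat" where e: "inj_on e K"
    using finite_imp_inj_to_nat_seg[OF K(1)] by metis
  define I where "I = (\<lambda>k. (fst k, e k)) ` K"
  define g where "g = (\<lambda>p\<in>I. snd (inv_into K e (snd p)))"
  have inv: "inv_into K e (e k) = k" if "k \<in> K" for k using e that by simp
  have I: "I \<in> index_sets" unfolding index_sets_def I_def using K(1,2) by auto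
  have gk: "g (fst k, e k) = snd k" if "k \<in> K" for k
    using that inv unfolding g_def I_def by auto
  have "g \<in> (\<Pi>\<^sub>E p\<in>I. T (fst p))"
  proof (rule PiE_I)
    fix p assume "p \<in> I"
    then obtain k where k: "k \<in> K" "p = (fst k, e k)" unfolding I_def by blast
    then show "g p \<in> T (fst p)" using gk[OF k(1)] K(2) by auto
  next
    fix p assume "p \<notin> I"
    then show "g p = undefined" unfolding g_def by simp
  qed
  moreover have "cuts I g = K"
    unfolding cuts_def I_def image_image using gk by force
  ultimately have "(x, g) \<in> grid_pairs X f \<delta> I"
    unfolding grid_pairs_def using x K(3) topspace_cut_space[OF I] by simp
  then show ?thesis using I by force
qed

text \<open>In a minimal grid the cuts on each axis are therefore pairwise distinct.\<close>

lemma grid_pairs_remove: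
  assumes I: "I \<in> index_sets" and xg: "(x, g) \<in> grid_pairs X f \<delta> I"
    and pq: "p \<in> I" "q \<in> I" "p \<noteq> q" "fst p = fst q" "g p = g q"
  shows "x \<in> fst ` grid_pairs X f \<delta> (I - {q})"
proof -
  have I': "I - {q} \<in> index_sets" using I unfolding index_sets_def by auto
  let ?g = "restrict g (I - {q})"
  \<comment> \<open>No cut is lost with the label \<open>q\<close>, since \<open>p\<close> carries
    the same one.\<close>
  have "cuts (I - {q}) ?g = cuts I g"
  proof -
    have "cuts (I - {q}) ?g = (\<lambda>p. (fst p, g p)) ` (I - {q})"
      unfolding cuts_def by (intro image_cong) auto
    also have "\<dots> = cuts I g"
      unfolding cuts_def
    proof
      show "(\<lambda>p. (fst p, g p)) ` I \<subseteq> (\<lambda>p. (fst p, g p)) ` (I - {q})"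
      proof
        fix k assume "k \<in> (\<lambda>p. (fst p, g p)) ` I"
        then obtain s where s: "s \<in> I" "k = (fst s, g s)" by blast
        show "k \<in> (\<lambda>p. (fst p, g p)) ` (I - {q})"
        proof (cases "s = q")
          case True
          then show ?thesis using s pq by (intro image_eqI[of _ _ p]) auto
        next
          case False
          then show ?thesis using s by blast
        qed
      qed
    qed blast
    finally show ?thesis .
  qed
  moreover have "?g \<in> topspace (cut_space (I - {q}))"
    using xg unfolding grid_pairs_def topspace_cut_space[OF I] topspace_cut_space[OF I']
    by (auto simp: PiE_iff)
  ultimately have "(x, ?g) \<in> grid_pairs X f \<delta> (I - {q})"
    using xg unfolding grid_pairs_def by simp
  then show ?thesis by force
qed

lemma countable_index_sets: "countable index_sets"
  unfolding index_sets_def by (rule countable_subset[OF _ countable_Collect_finite]) auto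

text \<open>Category yields a shape whose closed set of points contains a nonempty open part of
  \<open>U\<close>; a shape with the fewest labels is taken. Shapes with one label fewer have closed
  sets without interior in \<open>V\<close>, so these finitely many sets can be removed from
  \<open>V\<close>.\<close>

lemma minimal_grids:
  assumes X: "Baire_space X" and f: "separately_continuous X (subtopology P Y) f" and "\<delta> > 0"
    and U: "openin X U" "U \<noteq> {}"
  shows "\<exists>I\<in>index_sets. \<exists>V. openin X V \<and> V \<noteq> {} \<and> V \<subseteq> U \<and> V \<subseteq> fst ` grid_pairs X f \<delta> I \<and>
    (\<forall>x\<in>V. \<forall>q\<in>I. x \<notin> fst ` grid_pairs X f \<delta> (I - {q}))"
proof -
  let ?X = "\<lambda>I. fst ` grid_pairs X f \<delta> I"
  define fat where
    "fat I \<longleftrightarrow> I \<in> index_sets \<and> (\<exists>V. openin X V \<and> V \<noteq> {} \<and> V \<subseteq> U \<inter> ?X I)" for I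
  have cl: "closedin X (?X I)" if "I \<in> index_sets" for I
    by (rule closedin_fst_image[OF that closedin_grid_pairs[OF f that]])
  have "\<exists>C\<in>?X ` index_sets. \<exists>V. openin X V \<and> V \<noteq> {} \<and> V \<subseteq> U \<inter> C"
  proof (rule Baire_space_open_subset_closed[OF X U])
    show "countable (?X ` index_sets)" using countable_index_sets by (rule countable_image)
    show "\<And>C. C \<in> ?X ` index_sets \<Longrightarrow> closedin X C" using cl by blast
    show "U \<subseteq> \<Union>(?X ` index_sets)"
      using grid_pairs_cover[OF f \<open>\<delta> > 0\<close>] openin_subset[OF U(1)] by blast
  qed
  then obtain I0 where "fat I0" unfolding fat_def by blast
  then obtain I where I: "fat I" and min: "\<And>J. fat J \<Longrightarrow> card I \<le> card J"
    using ex_has_least_nat[of fat I0 card] by blast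
  have II: "I \<in> index_sets" and fin: "finite I"
    using I unfolding fat_def index_sets_def by auto
  obtain V where V: "openin X V" "V \<noteq> {}" "V \<subseteq> U \<inter> ?X I" using I unfolding fat_def by blast
  let ?C = "(\<lambda>q. ?X (I - {q})) ` I"
  have I': "I - {q} \<in> index_sets" for q using II unfolding index_sets_def by auto
  have "openin X (V - \<Union>?C) \<and> V - \<Union>?C \<noteq> {}"
  proof (rule open_minus_finite_closed_nonempty)
    show "finite ?C" using fin by simp
    show "openin X V" "V \<noteq> {}" by (rule V)+
    show "closedin X C" if "C \<in> ?C" for C using that cl[OF I'] by blast
    show "\<not> W \<subseteq> C" if C: "C \<in> ?C" and W: "openin X W" "W \<noteq> {}" "W \<subseteq> V" for C W
    proof
      assume "W \<subseteq> C"
      obtain q where q: "q \<in> I" "C = ?X (I - {q})" using C by blast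
      have "W \<subseteq> U \<inter> ?X (I - {q})" using W(3) V(3) \<open>W \<subseteq> C\<close> q(2) by blast
      with I'[of q] W(1,2) have "fat (I - {q})" unfolding fat_def by (intro conjI exI[of _ W])
      then have "card I \<le> card (I - {q})" by (rule min)
      then show False using q(1) fin card_Diff1_less[of I q] by simp
    qed
  qed
  then show ?thesis
    using V(3) II by (intro bexI[of _ I] exI[of _ "V - \<Union>?C"]) auto
qed

text \<open>Compactness of the cut space enters twice: the grids over \<open>x\<close> form a
  compact set, which gives one finite \<open>H\<close> separating all of them, and a closed
  projection then extends this \<open>H\<close> to the grids over a neighbourhood of
  \<open>x\<close>.\<close>

lemma uniformly_separated_grids:
  assumes f: "separately_continuous X (subtopology P Y) f" and I: "I \<in> index_sets"
    and x: "x \<in> topspace X" and min: "\<And>q. q \<in> I \<Longrightarrow> x \<notin> fst ` grid_pairs X f \<delta> (I - {q})"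
  shows "\<exists>H W. finite H \<and> H \<subseteq> Sigma {1..n} T \<and> openin X W \<and> x \<in> W \<and>
    (\<forall>x'\<in>W. \<forall>g. (x', g) \<in> grid_pairs X f \<delta> I \<longrightarrow> separated I H g)"
proof -
  let ?Q = "cut_space I"
  let ?S = "\<lambda>H. {g \<in> topspace ?Q. separated I H g}"
  let ?\<H> = "{H. finite H \<and> H \<subseteq> Sigma {1..n} T}"
  define G where "G = {g \<in> topspace ?Q. (x, g) \<in> grid_pairs X f \<delta> I}"
  have "continuous_map ?Q (prod_topology X ?Q) (\<lambda>g. (x, g))"
    using x by (intro continuous_map_pairedI) auto
  then have "closedin ?Q G"
    unfolding G_def
    by (rule closedin_continuous_map_preimage) (rule closedin_grid_pairs[OF f I])
  then have "compactin ?Q G"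
    using compact_cut_space[OF I] closedin_compact_space by blast
  then have "\<exists>\<F>. finite \<F> \<and> \<F> \<subseteq> ?S ` ?\<H> \<and> G \<subseteq> \<Union>\<F>"
  proof (rule compactinD)
    show "openin ?Q U" if "U \<in> ?S ` ?\<H>" for U
      using that openin_separated[OF I] by blast
    show "G \<subseteq> \<Union>(?S ` ?\<H>)"
    proof
      fix g assume g: "g \<in> G"
      then have gQ: "g \<in> topspace ?Q" and xg: "(x, g) \<in> grid_pairs X f \<delta> I"
        unfolding G_def by auto
      have "g p \<noteq> g q" if "p \<in> I" "q \<in> I" "p \<noteq> q" "fst p = fst q" for p q
        using grid_pairs_remove[OF I xg that] min[OF that(2)] by blast
      from separated_exists[OF I gQ this] gQ show "g \<in> \<Union>(?S ` ?\<H>)" by blast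
    qed
  qed
  then obtain \<F> where \<F>: "finite \<F>" "\<F> \<subseteq> ?\<H>" "G \<subseteq> \<Union>(?S ` \<F>)"
    by (metis (no_types, lifting) finite_subset_image)
  define H where "H = \<Union>\<F>"
  have H: "finite H" "H \<subseteq> Sigma {1..n} T" unfolding H_def using \<F>(1,2) by blast+
  have GH: "G \<subseteq> ?S H"
  proof
    fix g assume "g \<in> G"
    then obtain H' where H': "H' \<in> \<F>" "g \<in> ?S H'" using \<F>(3) by blast
    then show "g \<in> ?S H" using separated_mono[of I H' g H] unfolding H_def by blast
  qed
  \<comment> \<open>These are the grids that \<open>H\<close> fails to separate. None lies over
    \<open>x\<close>, so the complement of their closed projection serves as
    \<open>W\<close>.\<close>
  define N where "N = grid_pairs X f \<delta> I \<inter> topspace X \<times> (topspace ?Q - ?S H)"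
  have "closedin (prod_topology X ?Q) N"
    unfolding N_def
    by (intro closedin_Int closedin_grid_pairs[OF f I] closedin_prod_Times_iff[THEN iffD2] disjI2
        conjI closedin_diff closedin_topspace openin_separated[OF I])
  then have "closedin X (fst ` N)" by (rule closedin_fst_image[OF I])
  then have "openin X (topspace X - fst ` N)" by blast
  moreover have "x \<in> topspace X - fst ` N" using x GH unfolding N_def G_def by auto
  moreover have "separated I H g"
    if "x' \<in> topspace X - fst ` N" "(x', g) \<in> grid_pairs X f \<delta> I" for x' g
  proof (rule ccontr)
    assume "\<not> separated I H g"
    then have "(x', g) \<in> N" using that unfolding N_def grid_pairs_def by auto
    then show False using that by force
  qed
  ultimately show ?thesis using H by blast
qed

lemma small_variation_open_subset:
  assumes X: "Baire_space X" and f: "separately_continuous X (subtopology P Y) f"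
    and U: "openin X U" "U \<noteq> {}" and \<epsilon>: "\<epsilon> > 0"
  shows "\<exists>V. openin X V \<and> V \<noteq> {} \<and> V \<subseteq> U \<and>
    (\<forall>x\<in>V. \<forall>x'\<in>V. \<forall>y\<in>Y. \<bar>f (x, y) - f (x', y)\<bar> \<le> \<epsilon>)"
proof -
  \<comment> \<open>Moving from \<open>y\<close> to a representative \<open>d\<close> costs
    \<open>3 ^ n * \<delta>\<close> in each of two sections, and comparing the two values at
    \<open>d\<close> through \<open>x0\<close> costs \<open>2 * \<delta>\<close>.\<close>
  define \<delta> where "\<delta> = \<epsilon> / (2 * 3 ^ n + 2)"
  have \<delta>: "\<delta> > 0" unfolding \<delta>_def using \<epsilon> by (intro divide_pos_pos add_pos_pos) auto
  have \<delta>\<epsilon>: "2 * (3 ^ n * \<delta>) + 2 * \<delta> = \<epsilon>"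
  proof -
    have "(0::real) < 2 * 3 ^ n + 2" by (intro add_pos_pos) auto
    moreover have "2 * (3 ^ n * \<delta>) + 2 * \<delta> = \<delta> * (2 * 3 ^ n + 2)" by (simp add: algebra_simps)
    ultimately show ?thesis by (simp add: \<delta>_def)
  qed
  obtain I V where I: "I \<in> index_sets" and V: "openin X V" "V \<noteq> {}" "V \<subseteq> U"
    "V \<subseteq> fst ` grid_pairs X f \<delta> I"
    "\<forall>x\<in>V. \<forall>q\<in>I. x \<notin> fst ` grid_pairs X f \<delta> (I - {q})"
    using minimal_grids[OF X f \<delta> U] by metis
  obtain x0 where x0: "x0 \<in> V" using V(2) by blast
  have x0X: "x0 \<in> topspace X" using x0 openin_subset[OF V(1)] by blast
  have "\<exists>H W. finite H \<and> H \<subseteq> Sigma {1..n} T \<and> openin X W \<and> x0 \<in> W \<and>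
      (\<forall>x'\<in>W. \<forall>g. (x', g) \<in> grid_pairs X f \<delta> I \<longrightarrow> separated I H g)"
    using V(5) x0 by (intro uniformly_separated_grids[OF f I x0X]) blast
  then obtain H W where H: "finite H" "H \<subseteq> Sigma {1..n} T"
    and W: "openin X W" "x0 \<in> W" "\<And>x' g. x' \<in> W \<Longrightarrow> (x', g) \<in> grid_pairs X f \<delta> I \<Longrightarrow> separated I H g"
    by metis
  \<comment> \<open>The grid \<open>g\<close> depends on \<open>x\<close>, but \<open>H\<close> does
    not, so the cells in this bound are the same for all \<open>x\<close> in
    \<open>V \<inter> W\<close>.\<close>
  have osc: "\<bar>f (x, u) - f (x, v)\<bar> \<le> 3 ^ n * \<delta>"
    if x: "x \<in> V \<inter> W" and uv: "u \<in> Y" "v \<in> Y" "same_cell r H u v" for x u v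
  proof -
    obtain g where g: "(x, g) \<in> grid_pairs X f \<delta> I" using x V(4) by auto
    then have gT: "g \<in> (\<Pi>\<^sub>E p\<in>I. T (fst p))" and gr: "grid (\<lambda>y. f (x, y)) \<delta> (cuts I g)"
      and xX: "x \<in> topspace X"
      unfolding grid_pairs_def topspace_cut_space[OF I] by auto
    have sep: "separated I H g" using W(3) g x by blast
    have "continuous_map (subtopology P Y) euclideanreal (\<lambda>y. f (x, y))"
      using f xX unfolding separately_continuous_def by blast
    then show ?thesis
    proof (rule oscillation_in_separated_cell[OF _ _ gr _ uv])
      show "cuts I g \<subseteq> Sigma {1..n} L"
      proof
        fix k assume "k \<in> cuts I g"
        then obtain p where p: "p \<in> I" "k = (fst p, g p)" unfolding cuts_def by blast
        have "g p \<in> T (fst p)" using gT p(1) by (rule PiE_mem)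
        then show "k \<in> Sigma {1..n} L"
          using p(2) index_fst[OF I p(1)] T_subset[OF index_fst[OF I p(1)]] by blast
      qed
      fix i c c' assume "(i, c) \<in> cuts I g" "(i, c') \<in> cuts I g" and "c \<noteq> c'"
      then obtain p q where pq: "p \<in> I" "q \<in> I" "i = fst p" "i = fst q" "c = g p" "c' = g q"
        unfolding cuts_def by blast
      then have "p \<noteq> q" using \<open>c \<noteq> c'\<close> by blast
      have "fst p = fst q" using pq(3,4) by simp
      with sep pq(1,2) \<open>p \<noteq> q\<close> have "split_by (r (fst p)) (H `` {fst p}) (g p) (g q)"
        unfolding separated_def by blast
      then show "split_by (r i) (H `` {i}) c c'" using pq(3,5,6) by simp
    qed
  qed
  have "H \<subseteq> Sigma {1..n} L" using H(2) T_subset by blast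
  from finite_cell_representatives[OF H(1) this]
  obtain D where D: "finite D" "D \<subseteq> Y" "\<And>y. y \<in> Y \<Longrightarrow> \<exists>d\<in>D. same_cell r H y d" by metis
  \<comment> \<open>Continuity in x is used at finitely many representatives only, so
    \<open>Z\<close> remains open.\<close>
  define Z where
    "Z = (\<Inter>d\<in>D. {x \<in> topspace X. f (x, d) \<in> ball (f (x0, d)) \<delta>}) \<inter> topspace X"
  have "openin X Z"
    unfolding Z_def
  proof (rule openin_INT[OF D(1)])
    fix d assume "d \<in> D"
    then have "d \<in> topspace (subtopology P Y)" using D(2) topspace_Y by blast
    then have "continuous_map X euclideanreal (\<lambda>x. f (x, d))"
      using f unfolding separately_continuous_def by blast
    then show "openin X {x \<in> topspace X. f (x, d) \<in> ball (f (x0, d)) \<delta>}"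
      by (rule openin_continuous_map_preimage) simp
  qed
  then have op: "openin X (V \<inter> W \<inter> Z)" by (rule openin_Int[OF openin_Int[OF V(1) W(1)]])
  have ne: "x0 \<in> V \<inter> W \<inter> Z" using x0 x0X W(2) \<delta> unfolding Z_def by simp
  have "\<bar>f (x, y) - f (x', y)\<bar> \<le> \<epsilon>"
    if x: "x \<in> V \<inter> W \<inter> Z" and x': "x' \<in> V \<inter> W \<inter> Z" and y: "y \<in> Y" for x x' y
  proof -
    obtain d where d: "d \<in> D" "same_cell r H y d" using D(3)[OF y] by blast
    then have "d \<in> Y" using D(2) by blast
    have "\<bar>f (x, y) - f (x, d)\<bar> \<le> 3 ^ n * \<delta>" "\<bar>f (x', y) - f (x', d)\<bar> \<le> 3 ^ n * \<delta>"
      using osc[OF _ y \<open>d \<in> Y\<close> d(2)] x x' by blast+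
    moreover have "\<bar>f (x0, d) - f (x, d)\<bar> < \<delta>" "\<bar>f (x0, d) - f (x', d)\<bar> < \<delta>"
      using x x' d(1) unfolding Z_def by (auto simp: dist_real_def)
    ultimately show ?thesis using \<delta>\<epsilon> by linarith
  qed
  with op ne V(3) show ?thesis
    by (intro exI[of _ "V \<inter> W \<inter> Z"] conjI ballI) (assumption | blast)+
qed

end

theorem theorem3p1:
  fixes n :: nat
    and L :: "nat \<Rightarrow> 'a set"
    and r :: "nat \<Rightarrow> 'a rel"
    and Y :: "(nat \<Rightarrow> 'a) set"
  defines "P \<equiv> product_topology (\<lambda>i. order_topology_on (L i) (r i)) {1..n}"
  assumes "\<And>i. i \<in> {1..n} \<Longrightarrow> linear_order_on (L i) (r i)"
    and "compactin P Y"
    and "\<And>a b. a \<in> (\<Pi>\<^sub>E i\<in>{1..n}. L i) \<Longrightarrow> b \<in> (\<Pi>\<^sub>E i\<in>{1..n}. L i) \<Longrightarrow>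
           connectedin P (Y \<inter> (\<Pi>\<^sub>E i\<in>{1..n}. order_interval (r i) (a i) (b i)))"
  shows "co_Namioka_space TYPE('x) (subtopology P Y)"
proof -
  interpret B: box_connected_compact n L r Y
    using assms(2-4) unfolding P_def by unfold_locales
  show ?thesis
    unfolding co_Namioka_space_def
  proof (intro conjI allI impI)
    show "compact_space (subtopology P Y)" by (rule compact_space_subtopology[OF assms(3)])
    fix X :: "'x topology" and f
    assume X: "Baire_space X" and f: "separately_continuous X (subtopology P Y) f"
    have "topspace (subtopology P Y) = Y"
      using B.topspace_Y unfolding P_def .
    then show "Namioka_property X (subtopology P Y) f"
      using B.small_variation_open_subset[OF X f[unfolded P_def]]
      by (intro Namioka_propertyI[OF X f]) simp
  qed
qed

end
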